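(* Let $\alpha$ and $\beta$ be elements of the semigroup $\mathcal{PO}_{\infty}(\mathbb{N}^3_{\leqslant})$. Then, for Green's relations $\mathcal{L},\mathcal{R},\mathcal{H},\mathcal{D}$ on $\mathcal{PO}_{\infty}(\mathbb{N}^3_{\leqslant})$, the following assertions hold: (i) $\alpha\mathcal{L}\beta$ if and only if $\alpha=\mu\beta$ for some $\mu\in H(\mathbb{I})$; (ii) $\alpha\mathcal{R}\beta$ if and only if $\alpha=\beta\nu$ for some $\nu\in H(\mathbb{I})$; (iii) $\alpha\mathcal{H}\beta$ if and only if $\alpha=\mu\beta=\beta\nu$ for some $\mu,\nu\in H(\mathbb{I})$; (iv) $\alpha\mathcal{D}\beta$ if and only if $\alpha=\mu\beta\nu$ for some $\mu,\nu\in H(\mathbb{I})$.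
   Context: $\mathbb{N}$ is the set of positive integers, and $\mathbb{N}^3_{\leqslant}$ is the set $\mathbb{N}^3$ with the product order: $(i_1,i_2,i_3)\leqslant(j_1,j_2,j_3)$ iff $i_k\le j_k$ for all $k$. A partial map $\alpha$ of a poset is monotone if $x\leqslant y$ implies $(x)\alpha\leqslant(y)\alpha$ for all $x,y\in\operatorname{dom}\alpha$. Maps are written on the right, and partial maps are composed by $(x)(\alpha\beta)=((x)\alpha)\beta$ with $\operatorname{dom}(\alpha\beta)=\{y\in\operatorname{dom}\alpha: (y)\alpha\in\operatorname{dom}\beta\}$. $\mathcal{PO}_{\infty}(\mathbb{N}^3_{\leqslant})$ is the semigroup, under this composition, of all injective monotone partial selfmaps $\alpha$ of $\mathbb{N}^3_{\leqslant}$ such that $\mathbb{N}^3\setminus\operatorname{dom}\alpha$ and $\mathbb{N}^3\setminus\operatorname{ran}\alpha$ are finite. Its identity is the identity map $\mathbb{I}$ of $\mathbb{N}^3$, and $H(\mathbb{I})$ is its group of units. Green's relations on a semigroup $S$: $a\mathcal{R}b$ iff $aS^1=bS^1$; $a\mathcal{L}b$ iff $S^1a=S^1b$; $\mathcal{D}=\mathcal{L}\circ\mathcal{R}=\mathcal{R}\circ\mathcal{L}$; $\mathcal{H}=\mathcal{L}\cap\mathcal{R}$. *)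

theory Defs
  imports "HOL-Algebra.Coset" "HOL-Library.Product_Order"
begin

text \<open>The set of triples of positive integers. The order \<open>\<le>\<close> on triples is the
  componentwise one, from \<^theory>\<open>HOL-Library.Product_Order\<close>.\<close>

definition N3 :: "(nat \<times> nat \<times> nat) set"
  where "N3 = {1..} \<times> {1..} \<times> {1..}"

definition PO_inf_carrier :: "((nat \<times> nat \<times> nat) \<rightharpoonup> (nat \<times> nat \<times> nat)) set"
  where "PO_inf_carrier =
    {\<alpha>. dom \<alpha> \<subseteq> N3 \<and> ran \<alpha> \<subseteq> N3
       \<and> inj_on \<alpha> (dom \<alpha>)
       \<and> mono_on (dom \<alpha>) (\<lambda>x. the (\<alpha> x))
       \<and> finite (N3 - dom \<alpha>) \<and> finite (N3 - ran \<alpha>)}"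

text \<open>Maps act on the right, so the product of \<open>\<alpha>\<close> and \<open>\<beta>\<close> applies \<open>\<alpha>\<close> first;
  \<open>\<circ>\<^sub>m\<close> applies its right argument first.\<close>

definition PO_inf :: "((nat \<times> nat \<times> nat) \<rightharpoonup> (nat \<times> nat \<times> nat)) monoid"
  where "PO_inf =
    \<lparr>carrier = PO_inf_carrier, mult = (\<lambda>\<alpha> \<beta>. \<beta> \<circ>\<^sub>m \<alpha>), one = Some |` N3\<rparr>"

text \<open>Green's relations. The principal one-sided ideals \<open>S\<^sup>1a\<close> and \<open>aS\<^sup>1\<close> are written
  as \<open>{a} \<union> Sa\<close> and \<open>{a} \<union> aS\<close>, so that no identity element of \<open>S\<close> is used.\<close>

definition green_L :: "('a, 'b) monoid_scheme \<Rightarrow> 'a rel"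
  where "green_L S = {(a, b). a \<in> carrier S \<and> b \<in> carrier S \<and>
    insert a (carrier S #>\<^bsub>S\<^esub> a) = insert b (carrier S #>\<^bsub>S\<^esub> b)}"

definition green_R :: "('a, 'b) monoid_scheme \<Rightarrow> 'a rel"
  where "green_R S = {(a, b). a \<in> carrier S \<and> b \<in> carrier S \<and>
    insert a (a <#\<^bsub>S\<^esub> carrier S) = insert b (b <#\<^bsub>S\<^esub> carrier S)}"

definition green_H :: "('a, 'b) monoid_scheme \<Rightarrow> 'a rel"
  where "green_H S = green_L S \<inter> green_R S"

definition green_D :: "('a, 'b) monoid_scheme \<Rightarrow> 'a rel"
  where "green_D S = green_L S O green_R S"

end

theory Submission
  imports Defs
begin

text \<open>
  Two \<open>\<L>\<close>-related elements satisfy \<open>\<alpha> = \<gamma>\<beta>\<close> and \<open>\<beta> = \<delta>\<alpha>\<close>, and injectivity makes the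
  restrictions of \<open>\<gamma>\<close> and \<open>\<delta>\<close> mutually inverse monotone bijections between \<open>dom \<alpha>\<close> and
  \<open>dom \<beta>\<close>. In the same way two \<open>\<R>\<close>-related elements have order isomorphic ranges. All these
  sets are cofinite in \<open>\<nat>\<^sup>3\<close>, so everything rests on a rigidity theorem
  (\<open>order_iso_cofinite_permutes_coords\<close>): an order isomorphism \<open>f\<close> between cofinite subsets
  \<open>A\<close>, \<open>B\<close> of \<open>\<nat>\<^sup>3\<close> is the restriction of a permutation of the coordinates, hence of a unit.
  That unit can replace \<open>\<gamma>\<close>. Conversely, multiplication by a unit can be undone. The
  assertions on \<open>\<H>\<close> and \<open>\<D>\<close> combine those on \<open>\<L>\<close> and \<open>\<R>\<close>.

  The difficulty in the rigidity theorem is that the missing points destroy the local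
  structure: covering relations, joins and meets of \<open>A\<close> need not be those of \<open>\<nat>\<^sup>3\<close>. Slabs
  \<open>{x \<in> A. x\<^sub>i \<le> a}\<close> survive, because they are infinite and can be recognised from their points
  far away. Call a nonempty directed down-set of \<open>A\<close> an ideal. The slabs are exactly the
  proper ideals \<open>I\<close> such that the proper ideals containing \<open>I\<close> form a chain
  (\<open>chain_above_iff_slab\<close>). Indeed an ideal consists of all points of \<open>A\<close> whose coordinates do
  not exceed the suprema of the coordinates on it. If the ideal is proper, one of these suprema
  is finite. If exactly one is finite, the ideal is a slab, and so is every larger proper
  ideal; if two are finite, the ideal lies in two incomparable slabs.

  This description is purely order theoretic, so \<open>f\<close> maps slabs to slabs and preserves their
  inclusions. Two slabs are comparable only if they have the same direction, so \<open>f\<close> induces a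
  permutation \<open>\<sigma>\<close> of the directions; and the slab \<open>x\<^sub>i \<le> a\<close> contains exactly \<open>a\<close> slabs, so \<open>f\<close>
  preserves the bound \<open>a\<close>. Hence \<open>x\<^sub>i \<le> a\<close> iff \<open>(f x)\<^bsub>\<sigma> i\<^esub> \<le> a\<close>, for all \<open>a\<close>, which says that
  \<open>x\<^sub>i = (f x)\<^bsub>\<sigma> i\<^esub>\<close>.
\<close>

section \<open>Coordinates of triples\<close>

definition coord :: "nat \<Rightarrow> nat \<times> nat \<times> nat \<Rightarrow> nat"
  where "coord i x = (if i = 0 then fst x else if i = 1 then fst (snd x) else snd (snd x))"

definition triple :: "(nat \<Rightarrow> nat) \<Rightarrow> nat \<times> nat \<times> nat"
  where "triple c = (c 0, c 1, c 2)"

lemma less_3_cases: "i < (3::nat) \<longleftrightarrow> i = 0 \<or> i = 1 \<or> i = 2"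
  by auto

lemma coord_triple [simp]: "i < 3 \<Longrightarrow> coord i (triple c) = c i"
  by (auto simp: less_3_cases coord_def triple_def)

lemma triple_le_iff: "x \<le> y \<longleftrightarrow> (\<forall>i<3. coord i x \<le> coord i y)"
  by (auto simp: less_3_cases coord_def less_eq_prod_def)

lemma triple_eq_iff: "x = y \<longleftrightarrow> (\<forall>i<3. coord i x = coord i y)"
  by (auto simp: less_3_cases coord_def prod_eq_iff)

lemma in_N3_iff: "x \<in> N3 \<longleftrightarrow> (\<forall>i<3. 1 \<le> coord i x)"
  by (auto simp: less_3_cases coord_def N3_def mem_Times_iff)

section \<open>Ideals of ordered sets\<close>

definition is_ideal :: "'a::order set \<Rightarrow> 'a set \<Rightarrow> bool"
  where "is_ideal A I \<longleftrightarrow> I \<subseteq> A \<and> I \<noteq> {} \<and> (\<forall>x\<in>I. \<forall>y\<in>A. y \<le> x \<longrightarrow> y \<in> I) \<and>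
    (\<forall>x\<in>I. \<forall>y\<in>I. \<exists>z\<in>I. x \<le> z \<and> y \<le> z)"

definition proper_ideal :: "'a::order set \<Rightarrow> 'a set \<Rightarrow> bool"
  where "proper_ideal A I \<longleftrightarrow> is_ideal A I \<and> I \<noteq> A"

text \<open>The intrinsic description of slabs (see \<open>chain_above_iff_slab\<close>), stated for any ordered
  set so that order isomorphisms preserve it.\<close>

definition chain_above :: "'a::order set \<Rightarrow> 'a set \<Rightarrow> bool"
  where "chain_above A I \<longleftrightarrow> proper_ideal A I \<and>
    (\<forall>J K. proper_ideal A J \<and> proper_ideal A K \<and> I \<subseteq> J \<and> I \<subseteq> K \<longrightarrow> J \<subseteq> K \<or> K \<subseteq> J)"

definition order_iso_on :: "'a::order set \<Rightarrow> 'b::order set \<Rightarrow> ('a \<Rightarrow> 'b) \<Rightarrow> bool"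
  where "order_iso_on A B f \<longleftrightarrow>
    bij_betw f A B \<and> (\<forall>x\<in>A. \<forall>y\<in>A. f x \<le> f y \<longleftrightarrow> x \<le> y)"

lemma order_iso_on_inv:
  assumes "order_iso_on A B f"
  shows "order_iso_on B A (inv_into A f)"
proof -
  have "bij_betw f A B" and le: "\<And>x y. x \<in> A \<Longrightarrow> y \<in> A \<Longrightarrow> f x \<le> f y \<longleftrightarrow> x \<le> y"
    using assms by (auto simp: order_iso_on_def)
  moreover from this have "inv_into A f x \<in> A \<and> f (inv_into A f x) = x" if "x \<in> B" for x
    using that by (auto simp: bij_betw_def f_inv_into_f inv_into_into)
  ultimately show ?thesis
    unfolding order_iso_on_def by (metis bij_betw_inv_into)
qed

lemma order_iso_on_image_inv:
  assumes "order_iso_on A B f"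
  shows "I \<subseteq> A \<Longrightarrow> inv_into A f ` f ` I = I" "J \<subseteq> B \<Longrightarrow> f ` inv_into A f ` J = J"
  using assms unfolding order_iso_on_def bij_betw_def
  by (metis inv_into_image_cancel, metis image_inv_into_cancel)

lemma is_ideal_image:
  assumes f: "order_iso_on A B f" and I: "is_ideal A I"
  shows "is_ideal B (f ` I)"
proof -
  have B: "B = f ` A" and le: "\<And>x y. x \<in> A \<Longrightarrow> y \<in> A \<Longrightarrow> f x \<le> f y \<longleftrightarrow> x \<le> y"
    using f by (auto simp: order_iso_on_def bij_betw_def)
  have IA: "I \<subseteq> A" and ne: "I \<noteq> {}"
    and down: "\<And>x y. x \<in> I \<Longrightarrow> y \<in> A \<Longrightarrow> y \<le> x \<Longrightarrow> y \<in> I"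
    and dir: "\<And>x y. x \<in> I \<Longrightarrow> y \<in> I \<Longrightarrow> \<exists>z\<in>I. x \<le> z \<and> y \<le> z"
    using I by (auto simp: is_ideal_def)
  have "\<exists>z\<in>f ` I. f x \<le> z \<and> f y \<le> z" if "x \<in> I" "y \<in> I" for x y
    using dir[OF that] that IA le by (metis image_eqI subsetD)
  moreover have "f y \<in> f ` I" if "x \<in> I" "y \<in> A" "f y \<le> f x" for x y
    using down[OF that(1,2)] that IA le by blast
  ultimately show ?thesis
    using IA ne unfolding is_ideal_def B by auto
qed

lemma proper_ideal_image:
  assumes f: "order_iso_on A B f" and I: "proper_ideal A I"
  shows "proper_ideal B (f ` I)"
proof -
  have "I \<subseteq> A" "I \<noteq> A" using I by (auto simp: proper_ideal_def is_ideal_def)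
  moreover have "inv_into A f ` B = A"
    using order_iso_on_inv[OF f] by (auto simp: order_iso_on_def bij_betw_def)
  ultimately have "f ` I \<noteq> B"
    using order_iso_on_image_inv(1)[OF f] by metis
  then show ?thesis
    using is_ideal_image[OF f] I by (auto simp: proper_ideal_def)
qed

lemma chain_above_image:
  assumes f: "order_iso_on A B f" and I: "chain_above A I"
  shows "chain_above B (f ` I)"
proof -
  let ?g = "inv_into A f"
  have g: "order_iso_on B A ?g" using f by (rule order_iso_on_inv)
  have I': "proper_ideal A I" "I \<subseteq> A"
    using I by (auto simp: chain_above_def proper_ideal_def is_ideal_def)
  have "J \<subseteq> K \<or> K \<subseteq> J"
    if J: "proper_ideal B J" "f ` I \<subseteq> J" and K: "proper_ideal B K" "f ` I \<subseteq> K" for J K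
  proof -
    have "J \<subseteq> B" "K \<subseteq> B" using J K by (auto simp: proper_ideal_def is_ideal_def)
    moreover have "I \<subseteq> ?g ` J" "I \<subseteq> ?g ` K"
      using image_mono[OF J(2), of ?g] image_mono[OF K(2), of ?g]
        order_iso_on_image_inv(1)[OF f I'(2)] by auto
    then have "?g ` J \<subseteq> ?g ` K \<or> ?g ` K \<subseteq> ?g ` J"
      using I proper_ideal_image[OF g J(1)] proper_ideal_image[OF g K(1)]
      unfolding chain_above_def by blast
    ultimately show ?thesis
      using order_iso_on_image_inv(2)[OF f] by (metis image_mono)
  qed
  then show ?thesis
    using proper_ideal_image[OF f I'(1)] unfolding chain_above_def by blast
qed

section \<open>Slabs of cofinite sets of triples\<close>

definition slab :: "(nat \<times> nat \<times> nat) set \<Rightarrow> nat \<Rightarrow> nat \<Rightarrow> (nat \<times> nat \<times> nat) set"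
  where "slab A i a = {x \<in> A. coord i x \<le> a}"

definition cofinite_N3 :: "(nat \<times> nat \<times> nat) set \<Rightarrow> bool"
  where "cofinite_N3 A \<longleftrightarrow> A \<subseteq> N3 \<and> finite (N3 - A)"

text \<open>The points of a plane \<open>x\<^sub>i = a\<close> whose other coordinates are large avoid the finitely
  many missing points. They serve as upper bounds inside a slab, and as points that separate
  two slabs.\<close>

lemma cofinite_N3_far_point:
  assumes A: "cofinite_N3 A" and a: "1 \<le> a"
  obtains y where "y \<in> A" "i < 3 \<Longrightarrow> coord i y = a" "\<And>j. j < 3 \<Longrightarrow> j \<noteq> i \<Longrightarrow> N \<le> coord j y"
proof -
  define n where "n = Suc (N + (\<Sum>x\<in>N3 - A. coord 0 x + coord 1 x + coord 2 x))"
  define y where "y = triple (\<lambda>j. if j = i then a else n)"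
  have fin: "finite (N3 - A)" using A by (simp add: cofinite_N3_def)
  have small: "coord j x < n" if x: "x \<in> N3 - A" and j: "j < 3" for j x
  proof -
    have "coord j x \<le> coord 0 x + coord 1 x + coord 2 x"
      using j by (auto simp: less_3_cases)
    also have "\<dots> \<le> (\<Sum>x\<in>N3 - A. coord 0 x + coord 1 x + coord 2 x)"
      by (rule member_le_sum[OF x]) (use fin in auto)
    finally show ?thesis by (simp add: n_def)
  qed
  \<comment> \<open>some direction differs from \<open>i\<close>, and there \<open>y\<close> exceeds every missing point\<close>
  obtain k :: nat where k: "k < 3" "k \<noteq> i"
    by (metis zero_neq_one one_less_numeral_iff semiring_norm(77) zero_less_numeral)
  have "y \<in> N3" using a by (auto simp: in_N3_iff y_def n_def)
  moreover have "coord k y = n" using k by (simp add: y_def)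
  ultimately have "y \<in> A" using small[of y k] k by auto
  then show ?thesis
    using that[of y] by (auto simp: y_def n_def)
qed

lemma slab_subset_iff:
  assumes A: "cofinite_N3 A" and i: "i < 3" "j < 3" and a: "1 \<le> a"
  shows "slab A i a \<subseteq> slab A j b \<longleftrightarrow> i = j \<and> a \<le> b"
proof
  assume sub: "slab A i a \<subseteq> slab A j b"
  obtain y where y: "y \<in> A" "coord i y = a" "\<And>k. k < 3 \<Longrightarrow> k \<noteq> i \<Longrightarrow> Suc b \<le> coord k y"
    using cofinite_N3_far_point[OF A a, of i "Suc b"] i by metis
  then have "coord j y \<le> b" using sub by (auto simp: slab_def)
  then show "i = j \<and> a \<le> b" using y i by (metis not_less_eq_eq)
qed (auto simp: slab_def)

lemma slab_eq_iff:
  assumes "cofinite_N3 A" "i < 3" "j < 3" "1 \<le> a" "1 \<le> b"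
  shows "slab A i a = slab A j b \<longleftrightarrow> i = j \<and> a = b"
  using slab_subset_iff[OF assms(1-4), of b] slab_subset_iff[OF assms(1,3,2,5), of a]
  by (metis dual_order.refl le_antisym)

lemma proper_ideal_slab:
  assumes A: "cofinite_N3 A" and i: "i < 3" and a: "1 \<le> a"
  shows "proper_ideal A (slab A i a)"
proof -
  have "\<exists>z\<in>slab A i a. x \<le> z \<and> y \<le> z" if "x \<in> slab A i a" "y \<in> slab A i a" for x y
  proof -
    define N where "N = coord 0 x + coord 1 x + coord 2 x + coord 0 y + coord 1 y + coord 2 y"
    obtain z where z: "z \<in> A" "coord i z = a" "\<And>k. k < 3 \<Longrightarrow> k \<noteq> i \<Longrightarrow> N \<le> coord k z"
      using cofinite_N3_far_point[OF A a, of i N] i by metis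
    have N: "coord k x \<le> N \<and> coord k y \<le> N" if "k < 3" for k
      using that by (auto simp: less_3_cases N_def)
    have "coord k x \<le> coord k z \<and> coord k y \<le> coord k z" if "k < 3" for k
      using z N[OF that] that \<open>x \<in> slab A i a\<close> \<open>y \<in> slab A i a\<close>
      by (cases "k = i") (auto simp: slab_def intro: le_trans)
    then show ?thesis using z by (intro bexI[of _ z]) (auto simp: triple_le_iff slab_def)
  qed
  moreover have "slab A i a \<noteq> {}"
  proof -
    obtain y where "y \<in> A" "coord i y = a"
      using cofinite_N3_far_point[OF A a, of i 0] i by metis
    then have "y \<in> slab A i a" by (simp add: slab_def)
    then show ?thesis by blast
  qed
  moreover have "slab A i a \<noteq> A"
  proof -
    obtain y where "y \<in> A" "coord i y = Suc a"
      using cofinite_N3_far_point[OF A, of "Suc a" i 0] i by (metis le_add1 plus_1_eq_Suc)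
    then have "y \<notin> slab A i a" by (simp add: slab_def)
    then show ?thesis using \<open>y \<in> A\<close> by blast
  qed
  ultimately show ?thesis
    using i unfolding proper_ideal_def is_ideal_def
    by (auto simp: slab_def triple_le_iff intro: le_trans)
qed

text \<open>Directedness combines three elements, one for each direction, into a single element above
  \<open>x\<close>. An ideal is thus determined by the suprema of the coordinates on it.\<close>

lemma mem_ideal_of_coords:
  assumes I: "is_ideal A I" and x: "x \<in> A"
    and up: "\<And>i. i < 3 \<Longrightarrow> \<exists>y\<in>I. coord i x \<le> coord i y"
  shows "x \<in> I"
proof -
  have dir: "\<exists>z\<in>I. u \<le> z \<and> v \<le> z" if "u \<in> I" "v \<in> I" for u v
    using I that by (auto simp: is_ideal_def)
  obtain u v w where u: "u \<in> I" "coord 0 x \<le> coord 0 u" and v: "v \<in> I" "coord 1 x \<le> coord 1 v"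
    and w: "w \<in> I" "coord 2 x \<le> coord 2 w"
    using up[of 0] up[of 1] up[of 2] by auto
  obtain t where t: "t \<in> I" "u \<le> t" "v \<le> t" using dir u v by blast
  obtain z where z: "z \<in> I" "t \<le> z" "w \<le> z" using dir t w by blast
  have "x \<le> z"
    using u v w t z unfolding triple_le_iff less_3_cases by (metis le_trans)
  then show ?thesis using I x z by (auto simp: is_ideal_def)
qed

text \<open>An ideal unbounded in every direction but \<open>i\<close> contains every point below the supremum of its
  \<open>i\<close>-th coordinate; that supremum is finite, since otherwise the ideal would be everything.\<close>

lemma proper_ideal_eq_slab:
  assumes A: "cofinite_N3 A" and I: "proper_ideal A I"
    and unbd: "\<And>j b. j < 3 \<Longrightarrow> j \<noteq> i \<Longrightarrow> \<not> I \<subseteq> slab A j b"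
  obtains a where "1 \<le> a" "I = slab A i a" "i < 3"
proof -
  have id: "is_ideal A I" and IA: "I \<subseteq> A" and ne: "I \<noteq> {}" "I \<noteq> A"
    using I by (auto simp: proper_ideal_def is_ideal_def)
  have up: "\<exists>y\<in>I. N \<le> coord j y" if "j < 3" "j \<noteq> i" for j N
    using unbd[OF that, of N] IA by (auto simp: slab_def) (meson nle_le)
  obtain x where x: "x \<in> A" "x \<notin> I" using ne IA by blast
  then obtain k where k: "k < 3" "\<And>y. y \<in> I \<Longrightarrow> coord k y < coord k x"
    using mem_ideal_of_coords[OF id] by (metis not_le_imp_less)
  then have ki: "k = i" using up by (meson not_le)
  define a where "a = Max (coord i ` I)"
  have fin: "finite (coord i ` I)"
    using k ki by (auto intro!: finite_subset[of _ "{..<coord i x}"])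
  then have "a \<in> coord i ` I" using ne by (simp add: a_def)
  then obtain m where m: "m \<in> I" "coord i m = a" by blast
  have "I \<subseteq> slab A i a" using fin IA by (auto simp: slab_def a_def)
  moreover have "slab A i a \<subseteq> I"
    using mem_ideal_of_coords[OF id] up m by (metis (mono_tags, lifting) mem_Collect_eq slab_def subsetI)
  moreover have "1 \<le> a"
    using m IA A k ki by (auto simp: cofinite_N3_def in_N3_iff)
  ultimately show ?thesis using that k ki by blast
qed

text \<open>From left to right, two finite bounds in different directions would place \<open>I\<close> in two
  incomparable slabs. From right to left, an ideal above a slab is unbounded in the other
  directions, hence is itself a slab of the same direction if it is proper.\<close>

theorem chain_above_iff_slab:
  assumes A: "cofinite_N3 A"
  shows "chain_above A I \<longleftrightarrow> (\<exists>i<3. \<exists>a\<ge>1. I = slab A i a)"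
proof
  assume ch: "chain_above A I"
  then have I: "proper_ideal A I" by (simp add: chain_above_def)
  have ne: "\<exists>x. x \<in> I \<and> x \<in> A" using I by (auto simp: proper_ideal_def is_ideal_def)
  \<comment> \<open>two slabs of different directions are incomparable, so they cannot both contain \<open>I\<close>\<close>
  have uniq: "i = j" if "i < 3" "j < 3" "I \<subseteq> slab A i a" "I \<subseteq> slab A j b" for i j a b
  proof -
    have "1 \<le> a" "1 \<le> b"
      using ne that A by (force simp: slab_def cofinite_N3_def in_N3_iff)+
    then show ?thesis
      using ch that proper_ideal_slab[OF A] slab_subset_iff[OF A] unfolding chain_above_def
      by metis
  qed
  obtain i where "\<And>j b. j < 3 \<Longrightarrow> j \<noteq> i \<Longrightarrow> \<not> I \<subseteq> slab A j b"
    using uniq by metis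
  then show "\<exists>i<3. \<exists>a\<ge>1. I = slab A i a"
    using proper_ideal_eq_slab[OF A I] by metis
next
  assume "\<exists>i<3. \<exists>a\<ge>1. I = slab A i a"
  then obtain i a where i: "i < 3" "1 \<le> a" and I: "I = slab A i a" by blast
  have above: "\<exists>b\<ge>1. J = slab A i b" if J: "proper_ideal A J" "I \<subseteq> J" for J
  proof -
    have "\<not> J \<subseteq> slab A j b" if "j < 3" "j \<noteq> i" for j b
      using slab_subset_iff[OF A i(1) that(1) i(2), of b] J(2) that(2) I by blast
    then show ?thesis using proper_ideal_eq_slab[OF A J(1)] by metis
  qed
  have "J \<subseteq> K \<or> K \<subseteq> J" if "proper_ideal A J" "I \<subseteq> J" "proper_ideal A K" "I \<subseteq> K" for J K
    using above[OF that(1,2)] above[OF that(3,4)] by (auto simp: slab_def)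
  then show "chain_above A I"
    using proper_ideal_slab[OF A i] I unfolding chain_above_def by blast
qed

text \<open>This gives the bound of a slab an order-theoretic meaning, so that isomorphisms preserve
  it.\<close>

lemma card_chain_above_subset_slab:
  assumes A: "cofinite_N3 A" and i: "i < 3"
  shows "card {J. chain_above A J \<and> J \<subseteq> slab A i a} = a"
proof -
  have "chain_above A J \<and> J \<subseteq> slab A i a \<longleftrightarrow> (\<exists>b\<in>{1..a}. J = slab A i b)" for J
    unfolding chain_above_iff_slab[OF A] atLeastAtMost_iff Bex_def
    using i slab_subset_iff[OF A _ i, of _ _ a] by metis
  then have "{J. chain_above A J \<and> J \<subseteq> slab A i a} = slab A i ` {1..a}"
    by (simp add: image_def)
  moreover have "inj_on (slab A i) {1..a}"
    using slab_eq_iff[OF A i i] by (auto simp: inj_on_def)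
  ultimately show ?thesis by (simp add: card_image)
qed

section \<open>Rigidity of cofinite sets of triples\<close>

lemma order_iso_slab_image:
  assumes A: "cofinite_N3 A" and B: "cofinite_N3 B" and f: "order_iso_on A B f"
    and i: "i < 3" and a: "1 \<le> a"
  obtains j where "j < 3" "f ` slab A i a = slab B j a"
proof -
  have g: "order_iso_on B A (inv_into A f)" using f by (rule order_iso_on_inv)
  have sub: "J \<subseteq> A" if "chain_above A J" for J
    using that by (auto simp: chain_above_def proper_ideal_def is_ideal_def)
  have sub': "J \<subseteq> B" if "chain_above B J" for J
    using that by (auto simp: chain_above_def proper_ideal_def is_ideal_def)
  have S: "chain_above A (slab A i a)" using i a chain_above_iff_slab[OF A] by blast
  then obtain j b where j: "j < 3" "1 \<le> b" and eq: "f ` slab A i a = slab B j b"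
    using chain_above_image[OF f] chain_above_iff_slab[OF B] by metis
  have fwd: "chain_above B (f ` J) \<and> f ` J \<subseteq> slab B j b"
    if "chain_above A J" "J \<subseteq> slab A i a" for J
    using chain_above_image[OF f that(1)] image_mono[OF that(2), of f] eq by simp
  have "inv_into A f ` slab B j b = slab A i a"
    using order_iso_on_image_inv(1)[OF f sub[OF S]] eq by simp
  then have bwd: "chain_above A (inv_into A f ` J) \<and> inv_into A f ` J \<subseteq> slab A i a"
    if "chain_above B J" "J \<subseteq> slab B j b" for J
    using chain_above_image[OF g that(1)] image_mono[OF that(2), of "inv_into A f"] by simp
  have "bij_betw ((`) f) {J. chain_above A J \<and> J \<subseteq> slab A i a}
      {J. chain_above B J \<and> J \<subseteq> slab B j b}" (is "bij_betw _ ?S ?T")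
  proof (rule bij_betw_byWitness[where f' = "(`) (inv_into A f)"])
    show "\<forall>J\<in>?S. inv_into A f ` f ` J = J" "\<forall>J\<in>?T. f ` inv_into A f ` J = J"
      using order_iso_on_image_inv[OF f] sub sub' by simp_all
    have "f ` J \<in> ?T" if "J \<in> ?S" for J using fwd[of J] that by simp
    then show "(`) f ` ?S \<subseteq> ?T" by (rule image_subsetI)
    have "inv_into A f ` J \<in> ?S" if "J \<in> ?T" for J using bwd[of J] that by simp
    then show "(`) (inv_into A f) ` ?T \<subseteq> ?S" by (rule image_subsetI)
  qed
  then have "card ?S = card ?T" by (rule bij_betw_same_card)
  then have "a = b"
    by (simp only: card_chain_above_subset_slab[OF A i] card_chain_above_subset_slab[OF B j(1)])
  then show ?thesis using that j eq by blast
qed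

theorem order_iso_cofinite_permutes_coords:
  assumes A: "cofinite_N3 A" and B: "cofinite_N3 B" and f: "order_iso_on A B f"
  obtains \<tau> where "bij_betw \<tau> {..<3} {..<3}"
    "\<And>x. x \<in> A \<Longrightarrow> f x = triple (\<lambda>j. coord (\<tau> j) x)"
proof -
  have fA: "\<And>x. x \<in> A \<Longrightarrow> f x \<in> B" and inj: "inj_on f A"
    using f by (auto simp: order_iso_on_def bij_betw_def)
  have "\<exists>j<3. f ` slab A i 1 = slab B j 1" if "i < 3" for i
    by (rule order_iso_slab_image[OF A B f that le_refl]) blast
  then obtain \<sigma> where \<sigma>: "\<And>i. i < 3 \<Longrightarrow> \<sigma> i < 3 \<and> f ` slab A i 1 = slab B (\<sigma> i) 1"
    by metis
  have slab: "f ` slab A i a = slab B (\<sigma> i) a" if i: "i < 3" and a: "1 \<le> a" for i a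
  proof -
    obtain j where j: "j < 3" "f ` slab A i a = slab B j a"
      using order_iso_slab_image[OF A B f i a] .
    have "slab A i 1 \<subseteq> slab A i a" using a by (auto simp: slab_def)
    then have "slab B (\<sigma> i) 1 \<subseteq> slab B j a" using \<sigma>[OF i] j by blast
    then show ?thesis using slab_subset_iff[OF B _ j(1)] \<sigma>[OF i] j by force
  qed
  have coord: "coord (\<sigma> i) (f x) = coord i x" if i: "i < 3" and x: "x \<in> A" for i x
  proof -
    have le: "coord i x \<le> a \<longleftrightarrow> coord (\<sigma> i) (f x) \<le> a" if "1 \<le> a" for a
    proof -
      have "x \<in> slab A i a \<longleftrightarrow> f x \<in> f ` slab A i a"
        using x inj by (auto simp: slab_def inj_on_def)
      then show ?thesis using slab[OF i that] x fA by (auto simp: slab_def)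
    qed
    have "1 \<le> coord i x" "1 \<le> coord (\<sigma> i) (f x)"
      using A B x fA[OF x] i \<sigma>[OF i] by (auto simp: cofinite_N3_def in_N3_iff)
    then show ?thesis using le by (meson le_antisym le_refl)
  qed
  have "inj_on \<sigma> {..<3}"
  proof (rule inj_onI)
    fix i j assume ij: "i \<in> {..<(3::nat)}" "j \<in> {..<3}" "\<sigma> i = \<sigma> j"
    then have "f ` slab A i 1 = f ` slab A j 1" using \<sigma> by auto
    then have "slab A i 1 = slab A j 1"
      using inj by (metis (lifting) inj_on_image_eq_iff mem_Collect_eq slab_def subsetI)
    then show "i = j" using slab_eq_iff[OF A] ij by auto
  qed
  then have bij: "bij_betw \<sigma> {..<3} {..<3}"
    using \<sigma> by (simp add: bij_betw_def endo_inj_surj image_subset_iff)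
  \<comment> \<open>\<open>f\<close> moves the \<open>i\<close>-th coordinate to place \<open>\<sigma> i\<close>, so place \<open>j\<close> is read from \<open>inv \<sigma> j\<close>\<close>
  let ?\<tau> = "inv_into {..<3} \<sigma>"
  have "coord j (f x) = coord (?\<tau> j) x" if x: "x \<in> A" and j: "j < 3" for x j
  proof -
    have "?\<tau> j < 3" "\<sigma> (?\<tau> j) = j"
      using j bij_betw_inv_into_right[OF bij] bij_betwE[OF bij_betw_inv_into[OF bij]] by auto
    then show ?thesis using coord[OF _ x] by metis
  qed
  then have "f x = triple (\<lambda>j. coord (?\<tau> j) x)" if "x \<in> A" for x
    unfolding triple_eq_iff using that by simp
  then show ?thesis using that bij_betw_inv_into[OF bij] by blast
qed

section \<open>The monoid of monotone injective partial maps\<close>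

lemma PO_inf_simps [simp]:
  "carrier PO_inf = PO_inf_carrier" "\<alpha> \<otimes>\<^bsub>PO_inf\<^esub> \<beta> = \<beta> \<circ>\<^sub>m \<alpha>" "\<one>\<^bsub>PO_inf\<^esub> = Some |` N3"
  by (simp_all add: PO_inf_def)

lemma inj_on_dom_iff:
  "inj_on m (dom m) \<longleftrightarrow> (\<forall>x y u. m x = Some u \<longrightarrow> m y = Some u \<longrightarrow> x = y)"
proof
  assume "\<forall>x y u. m x = Some u \<longrightarrow> m y = Some u \<longrightarrow> x = y"
  then show "inj_on m (dom m)" by (auto intro!: inj_onI)
next
  assume "inj_on m (dom m)"
  then show "\<forall>x y u. m x = Some u \<longrightarrow> m y = Some u \<longrightarrow> x = y"
    by (metis domI inj_onD)
qed

lemma mono_on_dom_iff: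
  "mono_on (dom m) (\<lambda>x. the (m x)) \<longleftrightarrow>
    (\<forall>x y u v. m x = Some u \<longrightarrow> m y = Some v \<longrightarrow> x \<le> y \<longrightarrow> u \<le> v)"
proof
  assume "mono_on (dom m) (\<lambda>x. the (m x))"
  then show "\<forall>x y u v. m x = Some u \<longrightarrow> m y = Some v \<longrightarrow> x \<le> y \<longrightarrow> u \<le> v"
    by (metis domI mono_onD option.sel)
qed (auto intro!: mono_onI)

text \<open>Unlike the values \<open>the (\<alpha> x)\<close>, equations \<open>\<alpha> x = Some u\<close> carry the information that \<open>x\<close> is in
  the domain, and they unfold along a composition.\<close>

lemma PO_inf_carrier_iff:
  "\<alpha> \<in> PO_inf_carrier \<longleftrightarrow> cofinite_N3 (dom \<alpha>) \<and> cofinite_N3 (ran \<alpha>) \<and>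
    (\<forall>x y u. \<alpha> x = Some u \<longrightarrow> \<alpha> y = Some u \<longrightarrow> x = y) \<and>
    (\<forall>x y u v. \<alpha> x = Some u \<longrightarrow> \<alpha> y = Some v \<longrightarrow> x \<le> y \<longrightarrow> u \<le> v)"
  unfolding PO_inf_carrier_def cofinite_N3_def inj_on_dom_iff mono_on_dom_iff mem_Collect_eq
  by (simp only: conj_ac)

lemma finite_map_preimage:
  assumes "finite F" and "\<And>x y u. \<alpha> x = Some u \<Longrightarrow> \<alpha> y = Some u \<Longrightarrow> x = y"
  shows "finite {x. \<exists>u\<in>F. \<alpha> x = Some u}"
proof -
  have "inj_on (\<lambda>x. the (\<alpha> x)) {x. \<exists>u\<in>F. \<alpha> x = Some u}"
    using assms(2) by (auto simp: inj_on_def)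
  moreover have "(\<lambda>x. the (\<alpha> x)) ` {x. \<exists>u\<in>F. \<alpha> x = Some u} \<subseteq> F" by auto
  ultimately show ?thesis using assms(1) by (meson inj_on_finite)
qed

lemma dom_map_comp_subset: "dom (m \<circ>\<^sub>m n) \<subseteq> dom n"
  by (auto simp: map_comp_Some_iff)

lemma ran_map_comp_subset: "ran (m \<circ>\<^sub>m n) \<subseteq> ran m"
  by (auto simp: map_comp_Some_iff ran_def)

lemma PO_inf_carrier_comp:
  assumes \<alpha>: "\<alpha> \<in> PO_inf_carrier" and \<beta>: "\<beta> \<in> PO_inf_carrier"
  shows "\<beta> \<circ>\<^sub>m \<alpha> \<in> PO_inf_carrier"
proof -
  have inj: "\<And>x y u. \<alpha> x = Some u \<Longrightarrow> \<alpha> y = Some u \<Longrightarrow> x = y"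
    using \<alpha> by (auto simp: PO_inf_carrier_iff)
  have A: "dom \<alpha> \<subseteq> N3" "finite (N3 - dom \<alpha>)" "ran \<alpha> \<subseteq> N3" "finite (N3 - ran \<alpha>)"
    and B: "dom \<beta> \<subseteq> N3" "finite (N3 - dom \<beta>)" "ran \<beta> \<subseteq> N3" "finite (N3 - ran \<beta>)"
    using \<alpha> \<beta> by (auto simp: PO_inf_carrier_iff cofinite_N3_def)
  have "N3 - dom (\<beta> \<circ>\<^sub>m \<alpha>) \<subseteq> (N3 - dom \<alpha>) \<union> {x. \<exists>u\<in>N3 - dom \<beta>. \<alpha> x = Some u}"
  proof
    fix x assume x: "x \<in> N3 - dom (\<beta> \<circ>\<^sub>m \<alpha>)"
    show "x \<in> (N3 - dom \<alpha>) \<union> {x. \<exists>u\<in>N3 - dom \<beta>. \<alpha> x = Some u}"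
    proof (cases "\<alpha> x")
      case (Some u)
      then have "u \<in> N3" using A(3) by (auto intro: ranI)
      moreover have "u \<notin> dom \<beta>" using x Some by (auto simp: map_comp_def)
      ultimately show ?thesis using Some by blast
    qed (use x in auto)
  qed
  then have "finite (N3 - dom (\<beta> \<circ>\<^sub>m \<alpha>))"
    by (rule finite_subset)
      (intro finite_UnI A(2) finite_map_preimage[OF B(2)], use inj in blast)
  moreover have "N3 - ran (\<beta> \<circ>\<^sub>m \<alpha>) \<subseteq> (N3 - ran \<beta>) \<union> (\<lambda>x. the (\<beta> x)) ` (N3 - ran \<alpha>)"
  proof
    fix z assume z: "z \<in> N3 - ran (\<beta> \<circ>\<^sub>m \<alpha>)"
    show "z \<in> (N3 - ran \<beta>) \<union> (\<lambda>x. the (\<beta> x)) ` (N3 - ran \<alpha>)"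
    proof (cases "z \<in> ran \<beta>")
      case True
      obtain y where y: "\<beta> y = Some z" using True unfolding ran_def by blast
      have "y \<notin> ran \<alpha>"
      proof
        assume "y \<in> ran \<alpha>"
        then obtain x where "\<alpha> x = Some y" unfolding ran_def by blast
        then have "(\<beta> \<circ>\<^sub>m \<alpha>) x = Some z" using y by simp
        then show False using z ranI by (metis DiffD2)
      qed
      moreover have "y \<in> N3" using y B by auto
      ultimately show ?thesis using y by force
    qed (use z in auto)
  qed
  then have "finite (N3 - ran (\<beta> \<circ>\<^sub>m \<alpha>))"
    by (rule finite_subset) (intro finite_UnI finite_imageI A(4) B(4))
  moreover have "dom (\<beta> \<circ>\<^sub>m \<alpha>) \<subseteq> N3" "ran (\<beta> \<circ>\<^sub>m \<alpha>) \<subseteq> N3"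
    using A(1) B(3) dom_map_comp_subset[of \<beta> \<alpha>] ran_map_comp_subset[of \<beta> \<alpha>] by blast+
  moreover have "x = y" if xy: "(\<beta> \<circ>\<^sub>m \<alpha>) x = Some u" "(\<beta> \<circ>\<^sub>m \<alpha>) y = Some u" for x y u
  proof -
    obtain v w where v: "\<alpha> x = Some v" "\<beta> v = Some u" and w: "\<alpha> y = Some w" "\<beta> w = Some u"
      using xy unfolding map_comp_Some_iff by blast
    then have "v = w" using \<beta> unfolding PO_inf_carrier_iff by blast
    then show ?thesis using inj v w by blast
  qed
  moreover have "u \<le> v"
    if xy: "(\<beta> \<circ>\<^sub>m \<alpha>) x = Some u" "(\<beta> \<circ>\<^sub>m \<alpha>) y = Some v" "x \<le> y" for x y u v
  proof -
    obtain s t where s: "\<alpha> x = Some s" "\<beta> s = Some u" and t: "\<alpha> y = Some t" "\<beta> t = Some v"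
      using xy unfolding map_comp_Some_iff by blast
    then have "s \<le> t" using \<alpha> xy(3) unfolding PO_inf_carrier_iff by blast
    then show ?thesis using \<beta> s t unfolding PO_inf_carrier_iff by blast
  qed
  ultimately show ?thesis
    unfolding PO_inf_carrier_iff cofinite_N3_def by blast
qed

lemma map_eqI: "(\<And>x u. m x = Some u \<longleftrightarrow> n x = Some u) \<Longrightarrow> m = n"
  by (metis ext option.exhaust)

lemma map_comp_cong_ran: "(\<And>y. y \<in> ran n \<Longrightarrow> l y = m y) \<Longrightarrow> l \<circ>\<^sub>m n = m \<circ>\<^sub>m n"
  by (rule ext) (simp add: map_comp_def ranI split: option.split)

lemma map_comp_restrict_right_neutral: "dom m \<subseteq> X \<Longrightarrow> m \<circ>\<^sub>m (Some |` X) = m"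
  by (auto simp: fun_eq_iff map_comp_def restrict_map_def) (metis domIff subset_iff)

lemma map_comp_restrict_left_neutral: "ran m \<subseteq> X \<Longrightarrow> (Some |` X) \<circ>\<^sub>m m = m"
  by (auto simp: fun_eq_iff map_comp_def restrict_map_def ran_def split: option.splits)

lemma map_comp_assoc: "l \<circ>\<^sub>m (m \<circ>\<^sub>m n) = (l \<circ>\<^sub>m m) \<circ>\<^sub>m n"
  by (simp add: fun_eq_iff map_comp_def split: option.split)

lemma monoid_PO_inf: "monoid PO_inf"
proof
  have "dom (Some |` N3) = N3" "ran (Some |` N3) = N3"
    by (auto simp: ran_def restrict_map_def split: if_splits)
  then show "\<one>\<^bsub>PO_inf\<^esub> \<in> carrier PO_inf"
    by (auto simp: PO_inf_carrier_iff cofinite_N3_def restrict_map_def split: if_splits)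
  fix \<alpha> :: "(nat \<times> nat \<times> nat) \<rightharpoonup> (nat \<times> nat \<times> nat)" assume "\<alpha> \<in> carrier PO_inf"
  then have "dom \<alpha> \<subseteq> N3" "ran \<alpha> \<subseteq> N3"
    by (auto simp: PO_inf_carrier_iff cofinite_N3_def)
  then show "\<one>\<^bsub>PO_inf\<^esub> \<otimes>\<^bsub>PO_inf\<^esub> \<alpha> = \<alpha>" "\<alpha> \<otimes>\<^bsub>PO_inf\<^esub> \<one>\<^bsub>PO_inf\<^esub> = \<alpha>"
    by (simp_all add: map_comp_restrict_left_neutral map_comp_restrict_right_neutral)
qed (auto simp: PO_inf_carrier_comp map_comp_assoc)

definition permute_coords :: "(nat \<Rightarrow> nat) \<Rightarrow> (nat \<times> nat \<times> nat) \<rightharpoonup> (nat \<times> nat \<times> nat)"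
  where "permute_coords \<tau> = (\<lambda>x. Some (triple (\<lambda>j. coord (\<tau> j) x))) |` N3"

lemma permute_coords_comp:
  assumes \<tau>: "bij_betw \<tau> {..<3} {..<3}"
  shows "permute_coords \<tau> \<circ>\<^sub>m permute_coords (inv_into {..<3} \<tau>) = Some |` N3"
    and "permute_coords (inv_into {..<3} \<tau>) \<circ>\<^sub>m permute_coords \<tau> = Some |` N3"
proof -
  have cancel: "permute_coords \<sigma> \<circ>\<^sub>m permute_coords \<rho> = Some |` N3"
    if \<sigma>: "\<And>j. j < 3 \<Longrightarrow> \<sigma> j < 3" and \<rho>: "\<And>j. j < 3 \<Longrightarrow> \<rho> j < 3"
      and \<rho>\<sigma>: "\<And>j. j < 3 \<Longrightarrow> \<rho> (\<sigma> j) = j" for \<sigma> \<rho>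
    using that
    by (auto simp: fun_eq_iff map_comp_def permute_coords_def restrict_map_def in_N3_iff
        triple_eq_iff)
  let ?\<tau>' = "inv_into {..<3} \<tau>"
  have "\<And>j. j < 3 \<Longrightarrow> \<tau> j < 3" "\<And>j. j < 3 \<Longrightarrow> ?\<tau>' j < 3"
    "\<And>j. j < 3 \<Longrightarrow> ?\<tau>' (\<tau> j) = j" "\<And>j. j < 3 \<Longrightarrow> \<tau> (?\<tau>' j) = j"
    using bij_betwE[OF \<tau>] bij_betwE[OF bij_betw_inv_into[OF \<tau>]]
      bij_betw_inv_into_left[OF \<tau>] bij_betw_inv_into_right[OF \<tau>] by auto
  then show "permute_coords \<tau> \<circ>\<^sub>m permute_coords ?\<tau>' = Some |` N3"
    "permute_coords ?\<tau>' \<circ>\<^sub>m permute_coords \<tau> = Some |` N3"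
    using cancel by blast+
qed

lemma permute_coords_in_carrier:
  assumes \<tau>: "bij_betw \<tau> {..<3} {..<3}"
  shows "permute_coords \<tau> \<in> PO_inf_carrier"
proof -
  let ?\<tau>' = "inv_into {..<3} \<tau>"
  have lt: "\<And>j. j < 3 \<Longrightarrow> \<tau> j < 3" using bij_betwE[OF \<tau>] by auto
  have dom: "\<And>\<sigma>. dom (permute_coords \<sigma>) = N3"
    by (auto simp: permute_coords_def restrict_map_def split: if_splits)
  have sub: "ran (permute_coords \<tau>) \<subseteq> N3"
  proof
    fix z assume "z \<in> ran (permute_coords \<tau>)"
    then obtain x where "x \<in> N3" "z = triple (\<lambda>j. coord (\<tau> j) x)"
      unfolding ran_def permute_coords_def restrict_map_def by (simp split: if_splits) blast
    then show "z \<in> N3" using lt by (simp add: in_N3_iff)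
  qed
  have "z \<in> ran (permute_coords \<tau>)" if "z \<in> N3" for z
    using fun_cong[OF permute_coords_comp(1)[OF \<tau>], of z] that
    by (auto simp: map_comp_Some_iff ran_def)
  then have ran: "ran (permute_coords \<tau>) = N3" using sub by blast
  have inj: "x = y" if "permute_coords \<tau> x = Some u" "permute_coords \<tau> y = Some u" for x y u
  proof -
    have "x \<in> N3" "y \<in> N3" using that dom by blast+
    then show ?thesis
      using fun_cong[OF permute_coords_comp(2)[OF \<tau>], of x]
        fun_cong[OF permute_coords_comp(2)[OF \<tau>], of y] that
      by (auto simp: map_comp_def)
  qed
  have mono: "u \<le> v" if "permute_coords \<tau> x = Some u" "permute_coords \<tau> y = Some v" "x \<le> y" for x y u v
    using that lt by (auto simp: permute_coords_def restrict_map_def triple_le_iff split: if_splits)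
  show ?thesis
    unfolding PO_inf_carrier_iff using dom ran inj mono by (auto simp: cofinite_N3_def)
qed

lemma permute_coords_Units:
  assumes \<tau>: "bij_betw \<tau> {..<3} {..<3}"
  shows "permute_coords \<tau> \<in> Units PO_inf"
  unfolding Units_def
  using permute_coords_comp[OF \<tau>] permute_coords_in_carrier[OF \<tau>]
    permute_coords_in_carrier[OF bij_betw_inv_into[OF \<tau>]] by auto

text \<open>The form in which rigidity enters: the sets \<open>A\<close> and \<open>B\<close> will be the domains of two
  \<open>\<L>\<close>-related elements, or the ranges of two \<open>\<R>\<close>-related ones.\<close>

lemma inverse_pair_extends_to_unit:
  assumes \<gamma>: "\<gamma> \<in> PO_inf_carrier" and \<delta>: "\<delta> \<in> PO_inf_carrier"
    and A: "cofinite_N3 A" and B: "cofinite_N3 B"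
    and AB: "\<And>x. x \<in> A \<Longrightarrow> \<exists>y\<in>B. \<gamma> x = Some y \<and> \<delta> y = Some x"
    and BA: "\<And>y. y \<in> B \<Longrightarrow> \<exists>x\<in>A. \<delta> y = Some x \<and> \<gamma> x = Some y"
  obtains \<mu> where "\<mu> \<in> Units PO_inf" "\<And>x. x \<in> A \<Longrightarrow> \<mu> x = \<gamma> x"
proof -
  define f where "f = (\<lambda>x. the (\<gamma> x))"
  have f: "\<And>x. x \<in> A \<Longrightarrow> f x \<in> B \<and> \<gamma> x = Some (f x) \<and> \<delta> (f x) = Some x"
    using AB by (force simp: f_def)
  have "inj_on f A" using f by (metis inj_onI option.inject)
  moreover have "y \<in> f ` A" if "y \<in> B" for y
    using BA[OF that] by (metis f_def image_eqI option.sel)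
  then have "f ` A = B" using f by blast
  ultimately have "bij_betw f A B" by (rule bij_betw_imageI)
  moreover have "f x \<le> f y \<longleftrightarrow> x \<le> y" if "x \<in> A" "y \<in> A" for x y
    using f[OF that(1)] f[OF that(2)] \<gamma> \<delta> unfolding PO_inf_carrier_iff by meson
  ultimately have "order_iso_on A B f" by (simp add: order_iso_on_def)
  then obtain \<tau> where \<tau>: "bij_betw \<tau> {..<3} {..<3}"
    "\<And>x. x \<in> A \<Longrightarrow> f x = triple (\<lambda>j. coord (\<tau> j) x)"
    using order_iso_cofinite_permutes_coords[OF A B] by metis
  have "permute_coords \<tau> x = \<gamma> x" if "x \<in> A" for x
    using f[OF that] \<tau>(2)[OF that] A that by (auto simp: permute_coords_def cofinite_N3_def)
  then show ?thesis using that permute_coords_Units[OF \<tau>(1)] by blast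
qed

section \<open>Green's relations\<close>

lemma (in monoid) green_L_iff:
  assumes "a \<in> carrier G" "b \<in> carrier G"
  shows "(a, b) \<in> green_L G \<longleftrightarrow>
    (\<exists>c\<in>carrier G. a = c \<otimes> b) \<and> (\<exists>d\<in>carrier G. b = d \<otimes> a)"
proof -
  have self: "insert x (carrier G #> x) = carrier G #> x" if "x \<in> carrier G" for x
    using that by (auto simp: r_coset_def intro!: bexI[of _ \<one>])
  have sub: "carrier G #> x \<subseteq> carrier G #> y \<longleftrightarrow> (\<exists>c\<in>carrier G. x = c \<otimes> y)"
    if "x \<in> carrier G" "y \<in> carrier G" for x y
  proof
    assume "carrier G #> x \<subseteq> carrier G #> y"
    then show "\<exists>c\<in>carrier G. x = c \<otimes> y" using self[OF that(1)] unfolding r_coset_def by blast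
  next
    assume "\<exists>c\<in>carrier G. x = c \<otimes> y"
    then obtain c where c: "c \<in> carrier G" "x = c \<otimes> y" by blast
    have "h \<otimes> x = (h \<otimes> c) \<otimes> y \<and> h \<otimes> c \<in> carrier G" if "h \<in> carrier G" for h
      using c that \<open>y \<in> carrier G\<close> by (simp add: m_assoc)
    then show "carrier G #> x \<subseteq> carrier G #> y"
      unfolding r_coset_def using c by blast
  qed
  have "(a, b) \<in> green_L G \<longleftrightarrow> carrier G #> a = carrier G #> b"
    using assms by (simp only: green_L_def mem_Collect_eq case_prod_conv self simp_thms)
  then show ?thesis using assms by (simp only: set_eq_subset sub)
qed

lemma (in monoid) green_R_iff:
  assumes "a \<in> carrier G" "b \<in> carrier G"
  shows "(a, b) \<in> green_R G \<longleftrightarrow>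
    (\<exists>c\<in>carrier G. a = b \<otimes> c) \<and> (\<exists>d\<in>carrier G. b = a \<otimes> d)"
proof -
  have self: "insert x (x <# carrier G) = x <# carrier G" if "x \<in> carrier G" for x
    using that by (auto simp: l_coset_def intro!: bexI[of _ \<one>])
  have sub: "x <# carrier G \<subseteq> y <# carrier G \<longleftrightarrow> (\<exists>c\<in>carrier G. x = y \<otimes> c)"
    if "x \<in> carrier G" "y \<in> carrier G" for x y
  proof
    assume "x <# carrier G \<subseteq> y <# carrier G"
    then show "\<exists>c\<in>carrier G. x = y \<otimes> c" using self[OF that(1)] unfolding l_coset_def by blast
  next
    assume "\<exists>c\<in>carrier G. x = y \<otimes> c"
    then obtain c where c: "c \<in> carrier G" "x = y \<otimes> c" by blast
    have "x \<otimes> h = y \<otimes> (c \<otimes> h) \<and> c \<otimes> h \<in> carrier G" if "h \<in> carrier G" for h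
      using c that \<open>y \<in> carrier G\<close> by (simp add: m_assoc)
    then show "x <# carrier G \<subseteq> y <# carrier G"
      unfolding l_coset_def using c by blast
  qed
  have "(a, b) \<in> green_R G \<longleftrightarrow> a <# carrier G = b <# carrier G"
    using assms by (simp only: green_R_def mem_Collect_eq case_prod_conv self simp_thms)
  then show ?thesis using assms by (simp only: set_eq_subset sub)
qed

lemma (in monoid) green_L_of_unit:
  assumes "u \<in> Units G" "b \<in> carrier G"
  shows "(u \<otimes> b, b) \<in> green_L G"
proof -
  have "b = inv u \<otimes> (u \<otimes> b)"
    using assms by (simp add: m_assoc[symmetric] Units_closed)
  then show ?thesis
    using assms green_L_iff[of "u \<otimes> b" b] Units_closed Units_inv_closed by blast
qed

lemma (in monoid) green_R_of_unit:
  assumes "u \<in> Units G" "b \<in> carrier G"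
  shows "(b \<otimes> u, b) \<in> green_R G"
proof -
  have "b = (b \<otimes> u) \<otimes> inv u"
    using assms by (simp add: m_assoc Units_closed)
  then show ?thesis
    using assms green_R_iff[of "b \<otimes> u" b] Units_closed Units_inv_closed by blast
qed

lemma PO_inf_green_L_iff:
  assumes \<alpha>: "\<alpha> \<in> carrier PO_inf" and \<beta>: "\<beta> \<in> carrier PO_inf"
  shows "(\<alpha>, \<beta>) \<in> green_L PO_inf \<longleftrightarrow> (\<exists>\<mu>\<in>Units PO_inf. \<alpha> = \<mu> \<otimes>\<^bsub>PO_inf\<^esub> \<beta>)"
proof
  assume "(\<alpha>, \<beta>) \<in> green_L PO_inf"
  then obtain \<gamma> \<delta> where \<gamma>: "\<gamma> \<in> PO_inf_carrier" "\<alpha> = \<beta> \<circ>\<^sub>m \<gamma>"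
    and \<delta>: "\<delta> \<in> PO_inf_carrier" "\<beta> = \<alpha> \<circ>\<^sub>m \<delta>"
    using monoid.green_L_iff[OF monoid_PO_inf \<alpha> \<beta>] by auto
  have inj: "\<And>x y u. \<alpha> x = Some u \<Longrightarrow> \<alpha> y = Some u \<Longrightarrow> x = y"
    "\<And>x y u. \<beta> x = Some u \<Longrightarrow> \<beta> y = Some u \<Longrightarrow> x = y"
    using \<alpha> \<beta> by (auto simp: PO_inf_carrier_iff)
  have step: "\<alpha> x = Some u \<longleftrightarrow> (\<exists>y. \<gamma> x = Some y \<and> \<beta> y = Some u)"
    "\<beta> x = Some u \<longleftrightarrow> (\<exists>y. \<delta> x = Some y \<and> \<alpha> y = Some u)" for x u
    using map_comp_Some_iff[of \<beta> \<gamma> x u] map_comp_Some_iff[of \<alpha> \<delta> x u]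
    unfolding \<gamma>(2)[symmetric] \<delta>(2)[symmetric] .
  have fwd: "\<exists>y\<in>dom \<beta>. \<gamma> x = Some y \<and> \<delta> y = Some x" if "x \<in> dom \<alpha>" for x
  proof -
    from that obtain u where u: "\<alpha> x = Some u" unfolding dom_def by blast
    then obtain y where y: "\<gamma> x = Some y" "\<beta> y = Some u" using step(1) by blast
    then obtain z where "\<delta> y = Some z" "\<alpha> z = Some u" using step(2) by blast
    then show ?thesis using inj(1) u y by blast
  qed
  have bwd: "\<exists>x\<in>dom \<alpha>. \<delta> y = Some x \<and> \<gamma> x = Some y" if "y \<in> dom \<beta>" for y
  proof -
    from that obtain u where u: "\<beta> y = Some u" unfolding dom_def by blast
    then obtain x where x: "\<delta> y = Some x" "\<alpha> x = Some u" using step(2) by blast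
    then obtain z where "\<gamma> x = Some z" "\<beta> z = Some u" using step(1) by blast
    then show ?thesis using inj(2) u x by blast
  qed
  obtain \<mu> where \<mu>: "\<mu> \<in> Units PO_inf" "\<And>x. x \<in> dom \<alpha> \<Longrightarrow> \<mu> x = \<gamma> x"
    by (rule inverse_pair_extends_to_unit[OF \<gamma>(1) \<delta>(1) _ _ fwd bwd])
      (use \<alpha> \<beta> in \<open>auto simp: PO_inf_carrier_iff\<close>)
  have \<mu>_inj: "\<And>x y u. \<mu> x = Some u \<Longrightarrow> \<mu> y = Some u \<Longrightarrow> x = y"
    using \<mu>(1) unfolding Units_def by (auto simp: PO_inf_carrier_iff)
  have "\<alpha> x = Some u \<longleftrightarrow> (\<exists>y. \<mu> x = Some y \<and> \<beta> y = Some u)" for x u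
  proof
    assume "\<alpha> x = Some u"
    then show "\<exists>y. \<mu> x = Some y \<and> \<beta> y = Some u" using step(1) \<mu>(2) by (metis domI)
  next
    assume "\<exists>y. \<mu> x = Some y \<and> \<beta> y = Some u"
    then obtain y where y: "\<mu> x = Some y" "\<beta> y = Some u" by blast
    \<comment> \<open>\<open>\<mu>\<close> already maps \<open>dom \<alpha>\<close> onto \<open>dom \<beta>\<close>, so it sends no other point into \<open>dom \<beta>\<close>\<close>
    obtain x' where x': "x' \<in> dom \<alpha>" "\<gamma> x' = Some y" using bwd[of y] y by blast
    then have "x' = x" using \<mu>(2) \<mu>_inj y by metis
    then show "\<alpha> x = Some u" using step(1) x' y by blast
  qed
  then have "\<alpha> = \<beta> \<circ>\<^sub>m \<mu>"
    by (intro map_eqI) (simp only: map_comp_Some_iff)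
  then show "\<exists>\<mu>\<in>Units PO_inf. \<alpha> = \<mu> \<otimes>\<^bsub>PO_inf\<^esub> \<beta>" using \<mu>(1) by auto
next
  assume "\<exists>\<mu>\<in>Units PO_inf. \<alpha> = \<mu> \<otimes>\<^bsub>PO_inf\<^esub> \<beta>"
  then show "(\<alpha>, \<beta>) \<in> green_L PO_inf"
    using monoid.green_L_of_unit[OF monoid_PO_inf _ \<beta>] by blast
qed

lemma PO_inf_green_R_iff:
  assumes \<alpha>: "\<alpha> \<in> carrier PO_inf" and \<beta>: "\<beta> \<in> carrier PO_inf"
  shows "(\<alpha>, \<beta>) \<in> green_R PO_inf \<longleftrightarrow> (\<exists>\<nu>\<in>Units PO_inf. \<alpha> = \<beta> \<otimes>\<^bsub>PO_inf\<^esub> \<nu>)"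
proof
  assume "(\<alpha>, \<beta>) \<in> green_R PO_inf"
  then obtain \<gamma> \<delta> where \<gamma>: "\<gamma> \<in> PO_inf_carrier" "\<alpha> = \<gamma> \<circ>\<^sub>m \<beta>"
    and \<delta>: "\<delta> \<in> PO_inf_carrier" "\<beta> = \<delta> \<circ>\<^sub>m \<alpha>"
    using monoid.green_R_iff[OF monoid_PO_inf \<alpha> \<beta>] by auto
  have step: "\<alpha> x = Some u \<longleftrightarrow> (\<exists>y. \<beta> x = Some y \<and> \<gamma> y = Some u)"
    "\<beta> x = Some u \<longleftrightarrow> (\<exists>y. \<alpha> x = Some y \<and> \<delta> y = Some u)" for x u
    using map_comp_Some_iff[of \<gamma> \<beta> x u] map_comp_Some_iff[of \<delta> \<alpha> x u]
    unfolding \<gamma>(2)[symmetric] \<delta>(2)[symmetric] .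
  have fwd: "\<exists>z\<in>ran \<alpha>. \<gamma> y = Some z \<and> \<delta> z = Some y" if "y \<in> ran \<beta>" for y
  proof -
    from that obtain x where x: "\<beta> x = Some y" unfolding ran_def by blast
    then obtain z where z: "\<alpha> x = Some z" "\<delta> z = Some y" using step(2) by blast
    then have "\<gamma> y = Some z" using step(1) x by auto
    then show ?thesis using z by (auto intro: ranI)
  qed
  have bwd: "\<exists>y\<in>ran \<beta>. \<delta> z = Some y \<and> \<gamma> y = Some z" if "z \<in> ran \<alpha>" for z
  proof -
    from that obtain x where x: "\<alpha> x = Some z" unfolding ran_def by blast
    then obtain y where y: "\<beta> x = Some y" "\<gamma> y = Some z" using step(1) by blast
    then have "\<delta> z = Some y" using step(2) x by auto
    then show ?thesis using y by (auto intro: ranI)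
  qed
  obtain \<nu> where \<nu>: "\<nu> \<in> Units PO_inf" "\<And>y. y \<in> ran \<beta> \<Longrightarrow> \<nu> y = \<gamma> y"
    by (rule inverse_pair_extends_to_unit[OF \<gamma>(1) \<delta>(1) _ _ fwd bwd])
      (use \<alpha> \<beta> in \<open>auto simp: PO_inf_carrier_iff\<close>)
  have "\<alpha> = \<nu> \<circ>\<^sub>m \<beta>"
    unfolding \<gamma>(2) by (rule map_comp_cong_ran) (simp only: \<nu>(2))
  then show "\<exists>\<nu>\<in>Units PO_inf. \<alpha> = \<beta> \<otimes>\<^bsub>PO_inf\<^esub> \<nu>" using \<nu>(1) by auto
next
  assume "\<exists>\<nu>\<in>Units PO_inf. \<alpha> = \<beta> \<otimes>\<^bsub>PO_inf\<^esub> \<nu>"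
  then show "(\<alpha>, \<beta>) \<in> green_R PO_inf"
    using monoid.green_R_of_unit[OF monoid_PO_inf _ \<beta>] by blast
qed

lemma PO_inf_green_D_iff:
  assumes \<alpha>: "\<alpha> \<in> carrier PO_inf" and \<beta>: "\<beta> \<in> carrier PO_inf"
  shows "(\<alpha>, \<beta>) \<in> green_D PO_inf \<longleftrightarrow>
    (\<exists>\<mu>\<in>Units PO_inf. \<exists>\<nu>\<in>Units PO_inf. \<alpha> = \<mu> \<otimes>\<^bsub>PO_inf\<^esub> \<beta> \<otimes>\<^bsub>PO_inf\<^esub> \<nu>)"
proof -
  interpret monoid PO_inf by (rule monoid_PO_inf)
  note [simp del] = PO_inf_simps
  show ?thesis
  proof
    assume "(\<alpha>, \<beta>) \<in> green_D PO_inf"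
    then obtain \<chi> where L: "(\<alpha>, \<chi>) \<in> green_L PO_inf" and R: "(\<chi>, \<beta>) \<in> green_R PO_inf"
      by (auto simp: green_D_def)
    then have "\<chi> \<in> carrier PO_inf" by (auto simp: green_L_def)
    then obtain \<mu> \<nu> where "\<mu> \<in> Units PO_inf" "\<alpha> = \<mu> \<otimes>\<^bsub>PO_inf\<^esub> \<chi>"
      and "\<nu> \<in> Units PO_inf" "\<chi> = \<beta> \<otimes>\<^bsub>PO_inf\<^esub> \<nu>"
      using L R PO_inf_green_L_iff[OF \<alpha>] PO_inf_green_R_iff[OF _ \<beta>] by metis
    then show "\<exists>\<mu>\<in>Units PO_inf. \<exists>\<nu>\<in>Units PO_inf. \<alpha> = \<mu> \<otimes>\<^bsub>PO_inf\<^esub> \<beta> \<otimes>\<^bsub>PO_inf\<^esub> \<nu>"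
      using \<beta> m_assoc Units_closed by metis
  next
    assume "\<exists>\<mu>\<in>Units PO_inf. \<exists>\<nu>\<in>Units PO_inf. \<alpha> = \<mu> \<otimes>\<^bsub>PO_inf\<^esub> \<beta> \<otimes>\<^bsub>PO_inf\<^esub> \<nu>"
    then obtain \<mu> \<nu> where u: "\<mu> \<in> Units PO_inf" "\<nu> \<in> Units PO_inf"
      and "\<alpha> = \<mu> \<otimes>\<^bsub>PO_inf\<^esub> \<beta> \<otimes>\<^bsub>PO_inf\<^esub> \<nu>" by blast
    then have eq: "\<alpha> = \<mu> \<otimes>\<^bsub>PO_inf\<^esub> (\<beta> \<otimes>\<^bsub>PO_inf\<^esub> \<nu>)"
      using m_assoc[OF Units_closed[OF u(1)] \<beta> Units_closed[OF u(2)]] by simp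
    have "(\<alpha>, \<beta> \<otimes>\<^bsub>PO_inf\<^esub> \<nu>) \<in> green_L PO_inf"
      unfolding eq by (rule green_L_of_unit[OF u(1) m_closed[OF \<beta> Units_closed[OF u(2)]]])
    then show "(\<alpha>, \<beta>) \<in> green_D PO_inf"
      using green_R_of_unit[OF u(2) \<beta>] by (auto simp: green_D_def)
  qed
qed

theorem theorem3p6:
  fixes \<alpha> \<beta> :: "(nat \<times> nat \<times> nat) \<rightharpoonup> (nat \<times> nat \<times> nat)"
  assumes "\<alpha> \<in> carrier PO_inf" and "\<beta> \<in> carrier PO_inf"
  shows "((\<alpha>, \<beta>) \<in> green_L PO_inf \<longleftrightarrow>
           (\<exists>\<mu>\<in>Units PO_inf. \<alpha> = \<mu> \<otimes>\<^bsub>PO_inf\<^esub> \<beta>))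
       \<and> ((\<alpha>, \<beta>) \<in> green_R PO_inf \<longleftrightarrow>
           (\<exists>\<nu>\<in>Units PO_inf. \<alpha> = \<beta> \<otimes>\<^bsub>PO_inf\<^esub> \<nu>))
       \<and> ((\<alpha>, \<beta>) \<in> green_H PO_inf \<longleftrightarrow>
           (\<exists>\<mu>\<in>Units PO_inf. \<exists>\<nu>\<in>Units PO_inf.
              \<alpha> = \<mu> \<otimes>\<^bsub>PO_inf\<^esub> \<beta> \<and> \<alpha> = \<beta> \<otimes>\<^bsub>PO_inf\<^esub> \<nu>))
       \<and> ((\<alpha>, \<beta>) \<in> green_D PO_inf \<longleftrightarrow>
           (\<exists>\<mu>\<in>Units PO_inf. \<exists>\<nu>\<in>Units PO_inf.
              \<alpha> = \<mu> \<otimes>\<^bsub>PO_inf\<^esub> \<beta> \<otimes>\<^bsub>PO_inf\<^esub> \<nu>))"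
  unfolding green_H_def Int_iff PO_inf_green_L_iff[OF assms] PO_inf_green_R_iff[OF assms]
    PO_inf_green_D_iff[OF assms]
  by blast

end
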